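(* Let $\kappa_\infty,\sigma,T>0$ satisfy $\kappa_\infty\sigma^2T^2=\pi^2$. For $q\in\mathcal P_{\mathrm{sym}}(\kappa_\infty)$ let $\delta_{\mathrm{cp}}(q)$ be its critical-prefix length and let $\delta_{\mathrm{dec}}(q)$ be the number of stages executed by the decision algorithm described in the context, including its terminal stage. Then $$\delta_{\mathrm{dec}}(q)=\delta_{\mathrm{cp}}(q)+1<\infty\qquad\text{for every }q\in\mathcal P_{\mathrm{sym}}(\kappa_\infty),$$ but $$\sup_{q\in\mathcal P_{\mathrm{sym}}(\kappa_\infty)}\delta_{\mathrm{dec}}(q)=\infty.$$
   Context: Class $\mathcal D$: all $\lambda\in C^1(\mathbb R)$ that are strictly decreasing with $\lambda(\theta)=0$ for some (unique) $\theta\in\mathbb R$. Class $\mathcal D_\star$: all $\lambda\in\mathcal D$ that are superlinear, $|\lambda(y)|/|y-\theta|\to\infty$ as $|y-\theta|\to\infty$, and drift-dominated, $\limsup_{|y|\to\infty}\sigma^2q(y)/\lambda(y)^2=0$, where $q=-\lambda'$. Constants. Let $e_1(s)=\sqrt{2/T}\,\sin(\pi s/T)$, $I_p=\int_0^Te_1(s)^p\,\mathrm ds$, $J_{4/3}=\int_0^\pi\sin^{4/3}u\,\mathrm du$, $$b_*=\frac{3^{4/3}\sigma^{1/3}\kappa_\infty^{5/6}}{2J_{4/3}},\qquad B_0=\frac{\sqrt2\,\pi}{\sigma^2T^{3/2}},\qquad v_*=\Big(\frac{3B_0}{4(b_*/2)I_{4/3}}\Big)^3.$$ Define $\beta_0=\frac43$,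 $\beta_{n+1}=\frac{\beta_n+2}{3}$, and $c_0^*=-b_*$, $c_{n+1}^*=\dfrac{2c_n^*}{\sigma^2(\beta_n+1)(\beta_n+2)I_{\beta_{n+1}}v_*^{\beta_{n+1}}}$ (all $c_n^*<0$). Class $\mathcal P_{\mathrm{sym}}(\kappa_\infty)$: all $q=-\lambda'$ with $\lambda\in\mathcal D_\star$, $\lambda(0)=0$, admitting an expansion $$q(y)=\kappa_\infty y^2+\sum_{j=1}^ma_j|y|^{p_j}+r(y),\qquad|y|\to\infty,$$ with $m\ge0$, $2>p_1>\cdots>p_m>1$, $a_j\ne0$, $r(y)=o(|y|)$. The integer $m$, the $p_j$ and the $a_j$ are uniquely determined by $q$. Critical-prefix length: $$\delta_{\mathrm{cp}}(q):=\max\Big(\{0\}\cup\Big\{k\ge1:\ q(y)=\kappa_\infty y^2+\sum_{j=0}^{k-1}c_j^*|y|^{\beta_j}+o(|y|^{\beta_{k-1}})\text{ as }|y|\to\infty\Big\}\Big).$$ Decision algorithm. Stages are numbered $n=0,1,2,\dots$, starting at $n=0$. At stage $n$, after the quadratic term and the first $n$ critical terms $c_0^*|y|^{\beta_0},\dots,c_{n-1}^*|y|^{\beta_{n-1}}$ have been removed from the finite power expansion of $q$, let $p$ and $a$ be the exponent and coefficient of the largest remaining power (if no power remains, set $p=\beta_n$, $a=0$). If $p\ne\beta_n$, stop. If $p=\beta_n$, compare $a$ with $c_n^*$: if $a\ne c_n^*$, stop; if $a=c_n^*$, advance to stage $n+1$. *)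

theory Defs
  imports "HOL-Analysis.Analysis" "HOL-Library.Landau_Symbols" "HOL-Library.Extended_Nat"
begin

definition class_D :: "(real \<Rightarrow> real) set" where
  "class_D = {lam. lam C1_differentiable_on UNIV \<and>
     strict_antimono_on UNIV lam \<and> (\<exists>\<theta>. lam \<theta> = 0)}"

text \<open>Strict monotonicity makes the zero \<open>\<theta>\<close> unique.  For each \<open>\<theta>\<close>, \<open>\<bar>y - \<theta>\<bar> \<rightarrow> \<infinity>\<close> is the same
  as \<open>\<bar>y\<bar> \<rightarrow> \<infinity>\<close>, i.e. the filter \<open>at_infinity\<close> on the real line.\<close>

definition class_D_star :: "real \<Rightarrow> (real \<Rightarrow> real) set" where
  "class_D_star \<sigma> = {lam \<in> class_D.
     (\<exists>\<theta>. lam \<theta> = 0 \<and> filterlim (\<lambda>y. \<bar>lam y\<bar> / \<bar>y - \<theta>\<bar>) at_top at_infinity) \<and>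
     Limsup at_infinity (\<lambda>y. ereal (\<sigma>\<^sup>2 * (- deriv lam y) / (lam y)\<^sup>2)) = 0}"

definition e1 :: "real \<Rightarrow> real \<Rightarrow> real" where
  "e1 T s = sqrt (2 / T) * sin (pi * s / T)"

definition I_const :: "real \<Rightarrow> real \<Rightarrow> real" where
  "I_const T p = integral {0..T} (\<lambda>s. e1 T s powr p)"

definition J43 :: real where
  "J43 = integral {0..pi} (\<lambda>u. sin u powr (4/3))"

definition b_star :: "real \<Rightarrow> real \<Rightarrow> real" where
  "b_star \<kappa> \<sigma> = 3 powr (4/3) * \<sigma> powr (1/3) * \<kappa> powr (5/6) / (2 * J43)"

definition B_zero :: "real \<Rightarrow> real \<Rightarrow> real" where
  "B_zero \<sigma> T = sqrt 2 * pi / (\<sigma>\<^sup>2 * T powr (3/2))"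

definition v_star :: "real \<Rightarrow> real \<Rightarrow> real \<Rightarrow> real" where
  "v_star \<kappa> \<sigma> T =
     (3 * B_zero \<sigma> T / (4 * (b_star \<kappa> \<sigma> / 2) * I_const T (4/3))) ^ 3"

primrec beta :: "nat \<Rightarrow> real" where
  "beta 0 = 4/3"
| "beta (Suc n) = (beta n + 2) / 3"

primrec c_star :: "real \<Rightarrow> real \<Rightarrow> real \<Rightarrow> nat \<Rightarrow> real" where
  "c_star \<kappa> \<sigma> T 0 = - b_star \<kappa> \<sigma>"
| "c_star \<kappa> \<sigma> T (Suc n) =
     2 * c_star \<kappa> \<sigma> T n /
       (\<sigma>\<^sup>2 * (beta n + 1) * (beta n + 2) * I_const T (beta (Suc n)) *
        v_star \<kappa> \<sigma> T powr beta (Suc n))"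

text \<open>The list \<open>[(p\<^sub>1, a\<^sub>1), \<dots>, (p\<^sub>m, a\<^sub>m)]\<close> collects the non-quadratic powers of the expansion in
  order of decreasing exponent; the empty list is the case \<open>m = 0\<close>.\<close>

definition power_expansion :: "real \<Rightarrow> (real \<Rightarrow> real) \<Rightarrow> (real \<times> real) list \<Rightarrow> bool" where
  "power_expansion \<kappa> q xs \<longleftrightarrow>
     sorted_wrt (>) (map fst xs) \<and>
     (\<forall>(p, a) \<in> set xs. 1 < p \<and> p < 2 \<and> a \<noteq> 0) \<and>
     (\<lambda>y. q y - (\<kappa> * y\<^sup>2 + (\<Sum>(p, a)\<leftarrow>xs. a * \<bar>y\<bar> powr p))) \<in> o[at_infinity](\<lambda>y. \<bar>y\<bar>)"

definition P_sym :: "real \<Rightarrow> real \<Rightarrow> (real \<Rightarrow> real) set" where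
  "P_sym \<kappa> \<sigma> = {q. \<exists>lam \<in> class_D_star \<sigma>. q = (\<lambda>y. - deriv lam y) \<and> lam 0 = 0 \<and>
     (\<exists>xs. power_expansion \<kappa> q xs)}"

text \<open>Two expansions of the same \<open>q\<close> coincide, since all exponents exceed \<open>1\<close> and all coefficients are
  nonzero; so the description denotes the expansion of every \<open>q\<close> that has one.\<close>

definition power_terms :: "real \<Rightarrow> (real \<Rightarrow> real) \<Rightarrow> (real \<times> real) list" where
  "power_terms \<kappa> q = (THE xs. power_expansion \<kappa> q xs)"

text \<open>The supremum is taken in the extended naturals: it is the maximum of the set if the set is
  finite, and \<open>\<infinity>\<close> otherwise.\<close>

definition delta_cp :: "real \<Rightarrow> real \<Rightarrow> real \<Rightarrow> (real \<Rightarrow> real) \<Rightarrow> enat" where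
  "delta_cp \<kappa> \<sigma> T q = Sup (enat ` ({0} \<union> {k. k \<ge> 1 \<and>
     (\<lambda>y. q y - (\<kappa> * y\<^sup>2 + (\<Sum>j<k. c_star \<kappa> \<sigma> T j * \<bar>y\<bar> powr beta j)))
       \<in> o[at_infinity](\<lambda>y. \<bar>y\<bar> powr beta (k - 1))}))"

text \<open>The pair \<open>(p, a)\<close> inspected at stage \<open>n\<close>, given the powers that remain.\<close>

definition leading_term :: "nat \<Rightarrow> (real \<times> real) list \<Rightarrow> real \<times> real" where
  "leading_term n xs = (case xs of [] \<Rightarrow> (beta n, 0) | x # _ \<Rightarrow> x)"

text \<open>\<open>executed \<kappa> \<sigma> T ts n xs\<close>: started on the non-quadratic terms \<open>ts\<close>, the algorithm executes
  stage \<open>n\<close>, with \<open>xs\<close> as the remaining terms.  It advances exactly when \<open>p = \<beta>\<^sub>n\<close> and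
  \<open>a = c\<^sub>n\<^sup>*\<close>, and the matched term is then removed.\<close>

inductive executed ::
  "real \<Rightarrow> real \<Rightarrow> real \<Rightarrow> (real \<times> real) list \<Rightarrow> nat \<Rightarrow> (real \<times> real) list \<Rightarrow> bool"
  for \<kappa> \<sigma> T :: real and ts :: "(real \<times> real) list" where
  start: "executed \<kappa> \<sigma> T ts 0 ts"
| advance: "executed \<kappa> \<sigma> T ts n xs \<Longrightarrow> leading_term n xs = (p, a) \<Longrightarrow>
     p = beta n \<Longrightarrow> a = c_star \<kappa> \<sigma> T n \<Longrightarrow>
     executed \<kappa> \<sigma> T ts (Suc n) (remove1 (beta n, c_star \<kappa> \<sigma> T n) xs)"

text \<open>The terminal stage is counted, since it is entered.  A run
  that never stops has length \<open>\<infinity>\<close>.\<close>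

definition delta_dec :: "real \<Rightarrow> real \<Rightarrow> real \<Rightarrow> (real \<Rightarrow> real) \<Rightarrow> enat" where
  "delta_dec \<kappa> \<sigma> T q =
     (let S = {n. \<exists>xs. executed \<kappa> \<sigma> T (power_terms \<kappa> q) n xs}
      in if finite S then enat (card S) else \<infinity>)"

end

(* Two sums of powers |y|^p with exponents at least b that differ by o(|y|^b) agree term by term, since
   the leading difference cannot cancel.  Hence the expansion of q is unique, and q satisfies the k-th
   critical-prefix condition iff its first k powers are the critical ones; this is also the condition
   for the algorithm to enter stage k.  Both lengths are thus read off the longest critical prefix of a
   finite list.  That prefix can be arbitrarily long: kappa y^2 + sum_{j<k} c_j^* |y|^{beta_j} + K
   belongs to the class once the constant K makes it positive. *)

theory Submission
  imports Defs
begin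

section \<open>Finite sums of powers of |y| and their growth at infinity\<close>

definition power_sum :: "(real \<times> real) list \<Rightarrow> real \<Rightarrow> real" where
  "power_sum xs y = (\<Sum>(p, a)\<leftarrow>xs. a * \<bar>y\<bar> powr p)"

lemma power_sum_Nil [simp]: "power_sum [] y = 0"
  by (simp add: power_sum_def)

lemma power_sum_Cons [simp]: "power_sum ((p, a) # xs) y = a * \<bar>y\<bar> powr p + power_sum xs y"
  by (simp add: power_sum_def)

lemma power_sum_append: "power_sum (xs @ ys) y = power_sum xs y + power_sum ys y"
  by (simp add: power_sum_def)

lemma filterlim_abs_at_infinity: "filterlim (\<lambda>y::real. \<bar>y\<bar>) at_top at_infinity"
  using filterlim_norm_at_top[where 'a = real] by (simp add: real_norm_def[abs_def])

lemma abs_powr_smallo_iff: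
  "(\<lambda>y::real. \<bar>y\<bar> powr p) \<in> o[at_infinity](\<lambda>y. \<bar>y\<bar> powr r) \<longleftrightarrow> p < r"
  by (rule powr_smallo_iff[OF filterlim_abs_at_infinity trivial_limit_at_infinity])

lemma abs_powr_bigo:
  "p \<le> r \<Longrightarrow> (\<lambda>y::real. \<bar>y\<bar> powr p) \<in> O[at_infinity](\<lambda>y. \<bar>y\<bar> powr r)"
  by (cases "p = r") (auto intro: landau_o.small_imp_big simp: abs_powr_smallo_iff)

lemma smallo_abs_powr_mono:
  assumes "f \<in> o[at_infinity](\<lambda>y::real. \<bar>y\<bar> powr p)" "p \<le> r"
  shows "f \<in> o[at_infinity](\<lambda>y. \<bar>y\<bar> powr r)"
  using assms landau_o.small_big_trans abs_powr_bigo by blast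

lemma power_sum_smallo:
  assumes "\<And>p a. (p, a) \<in> set xs \<Longrightarrow> p < r"
  shows "power_sum xs \<in> o[at_infinity](\<lambda>y. \<bar>y\<bar> powr r)"
  using assms
proof (induction xs)
  case Nil
  then show ?case by (simp add: power_sum_def[abs_def])
next
  case (Cons x xs)
  obtain p a where x: "x = (p, a)" by fastforce
  have "(\<lambda>y::real. a * \<bar>y\<bar> powr p) \<in> o[at_infinity](\<lambda>y. \<bar>y\<bar> powr r)"
    using Cons.prems x by (auto simp: abs_powr_smallo_iff)
  moreover have "power_sum xs \<in> o[at_infinity](\<lambda>y. \<bar>y\<bar> powr r)"
    using Cons by auto
  ultimately have "(\<lambda>y. a * \<bar>y\<bar> powr p + power_sum xs y) \<in> o[at_infinity](\<lambda>y. \<bar>y\<bar> powr r)"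
    by (rule sum_in_smallo)
  then show ?case by (simp add: x)
qed

lemma smallo_add_cancel:
  assumes "(\<lambda>y. f y + g y) \<in> o[F](h)" "g \<in> o[F](h)"
  shows "f \<in> o[F](h)"
  using sum_in_smallo(2)[OF assms] by simp

text \<open>As \<open>b \<le> p\<close>, the bound o(|y|^b) is also o(|y|^p). Once \<open>g\<close>
  is absorbed, a multiple of |y|^p would be o of |y|^p itself, which only the zero multiple
  is.\<close>

lemma leading_coefficient_zero:
  assumes "(\<lambda>y::real. a * \<bar>y\<bar> powr p + g y) \<in> o[at_infinity](\<lambda>y. \<bar>y\<bar> powr b)" "b \<le> p"
    and "g \<in> o[at_infinity](\<lambda>y. \<bar>y\<bar> powr p)"
  shows "a = 0"
proof (rule ccontr)
  assume "a \<noteq> 0"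
  have "(\<lambda>y. a * \<bar>y\<bar> powr p) \<in> o[at_infinity](\<lambda>y. \<bar>y\<bar> powr p)"
    by (rule smallo_add_cancel[OF smallo_abs_powr_mono[OF assms(1,2)] assms(3)])
  with \<open>a \<noteq> 0\<close> show False by (simp add: abs_powr_smallo_iff)
qed

section \<open>Uniqueness of finite power expansions\<close>

text \<open>The window 1 < p < 2 is kept out of this predicate, so that uniqueness can be stated for
  an arbitrary threshold \<open>b\<close> on the exponents.\<close>

definition power_list :: "(real \<times> real) list \<Rightarrow> bool" where
  "power_list xs \<longleftrightarrow> sorted_wrt (>) (map fst xs) \<and> (\<forall>(p, a) \<in> set xs. a \<noteq> 0)"

lemma power_list_Nil [simp]: "power_list []"
  by (simp add: power_list_def)

lemma power_list_Cons:
  "power_list ((p, a) # xs) \<longleftrightarrow> a \<noteq> 0 \<and> (\<forall>(r, c) \<in> set xs. r < p) \<and> power_list xs"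
  by (auto simp: power_list_def)

text \<open>The error is only controlled up to o(|y|^b), so exponents at least \<open>b\<close> are
  exactly those that it cannot hide. The heads are compared first: a strictly larger leading
  exponent has nothing to cancel against, and equal exponents force equal coefficients. The heads
  then drop out and induction applies to the tails.\<close>

lemma power_sum_inject:
  assumes "power_list xs" "power_list ys"
    and "\<forall>(p, a) \<in> set xs \<union> set ys. b \<le> p"
    and "(\<lambda>y. power_sum xs y - power_sum ys y) \<in> o[at_infinity](\<lambda>y. \<bar>y\<bar> powr b)"
  shows "xs = ys"
  using assms
proof (induction xs ys rule: list_induct2')
  case 1
  then show ?case by simp
next
  case (2 x xs)
  obtain p a where x: "x = (p, a)" by fastforce
  have "a = 0"
    using 2 by (intro leading_coefficient_zero[of a p "power_sum xs" b] power_sum_smallo)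
      (auto simp: x power_list_Cons)
  with 2 show ?case by (simp add: x power_list_Cons)
next
  case (3 y ys)
  obtain p a where y: "y = (p, a)" by fastforce
  have "(\<lambda>z. power_sum (y # ys) z) \<in> o[at_infinity](\<lambda>y. \<bar>y\<bar> powr b)"
    using 3(4) by simp
  then have "a = 0"
    using 3 by (intro leading_coefficient_zero[of a p "power_sum ys" b] power_sum_smallo)
      (auto simp: y power_list_Cons)
  with 3 show ?case by (simp add: y power_list_Cons)
next
  case (4 x xs y ys)
  obtain p a where x: "x = (p, a)" by fastforce
  obtain r c where y: "y = (r, c)" by fastforce
  note P = 4(2-5)[unfolded x y power_list_Cons]
  have xs: "power_sum xs \<in> o[at_infinity](\<lambda>y. \<bar>y\<bar> powr s)" if "p \<le> s" for s
    using P that by (intro power_sum_smallo) fastforce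
  have ys: "power_sum ys \<in> o[at_infinity](\<lambda>y. \<bar>y\<bar> powr s)" if "r \<le> s" for s
    using P that by (intro power_sum_smallo) fastforce
  have D: "(\<lambda>z. a * \<bar>z\<bar> powr p + power_sum xs z - (c * \<bar>z\<bar> powr r + power_sum ys z))
      \<in> o[at_infinity](\<lambda>y. \<bar>y\<bar> powr b)"
    using P(4) by simp
  \<comment> \<open>If one head dominates, the whole other list is of lower order, and the
    dominating coefficient would have to be zero.\<close>
  have "\<not> r < p"
  proof
    assume "r < p"
    have "power_sum (y # ys) \<in> o[at_infinity](\<lambda>y. \<bar>y\<bar> powr p)"
      using P \<open>r < p\<close> by (intro power_sum_smallo) (fastforce simp: y)
    then have "(\<lambda>z. power_sum xs z - power_sum (y # ys) z) \<in> o[at_infinity](\<lambda>y. \<bar>y\<bar> powr p)"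
      by (intro sum_in_smallo xs) auto
    with D have "a = 0"
      using P(3) by (intro leading_coefficient_zero[of a p _ b]) (auto simp: y algebra_simps)
    with P show False by simp
  qed
  moreover have "\<not> p < r"
  proof
    assume "p < r"
    have "power_sum (x # xs) \<in> o[at_infinity](\<lambda>y. \<bar>y\<bar> powr r)"
      using P \<open>p < r\<close> by (intro power_sum_smallo) (fastforce simp: x)
    then have *: "(\<lambda>z. power_sum (x # xs) z - power_sum ys z) \<in> o[at_infinity](\<lambda>y. \<bar>y\<bar> powr r)"
      by (intro sum_in_smallo ys) auto
    \<comment> \<open>The term with coefficient \<open>c\<close> stands on the subtracted side, so
      it enters the difference as a leading term with coefficient \<open>- c\<close>.\<close>
    have "- c = 0"
      by (rule leading_coefficient_zero[OF _ _ *, of _ b]) (use P D in \<open>auto simp: x algebra_simps\<close>)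
    with P show False by simp
  qed
  ultimately have pr: "p = r" by simp
  have "(\<lambda>z. power_sum xs z - power_sum ys z) \<in> o[at_infinity](\<lambda>y. \<bar>y\<bar> powr p)"
    by (intro sum_in_smallo xs ys) (auto simp: pr)
  then have "a - c = 0"
    by (rule leading_coefficient_zero[rotated 2, of _ _ _ b]) (use P D in \<open>auto simp: pr algebra_simps\<close>)
  with pr D have "(\<lambda>z. power_sum xs z - power_sum ys z) \<in> o[at_infinity](\<lambda>y. \<bar>y\<bar> powr b)"
    by simp
  with 4(1) P have "xs = ys" by auto
  with pr \<open>a - c = 0\<close> show ?case by (simp add: x y)
qed

text \<open>Because the exponents decrease, those that are at least \<open>b\<close> form an initial
  segment of the list, so filtering does not reorder anything.\<close>

lemma power_list_split:
  "power_list xs \<Longrightarrow> xs = filter (\<lambda>(p, a). b \<le> p) xs @ filter (\<lambda>(p, a). p < b) xs"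
proof (induction xs)
  case (Cons x xs)
  obtain p a where x: "x = (p, a)" by fastforce
  show ?case
  proof (cases "b \<le> p")
    case True
    then show ?thesis using Cons by (simp add: x power_list_Cons)
  next
    case False
    then have "filter (\<lambda>(p, a). b \<le> p) xs = []" "filter (\<lambda>(p, a). p < b) xs = xs"
      using Cons.prems by (auto simp: x power_list_Cons filter_empty_conv filter_id_conv)
    with False show ?thesis by (simp add: x)
  qed
qed simp

lemma power_list_filter: "power_list xs \<Longrightarrow> power_list (filter P xs)"
  by (induction xs) (auto simp: power_list_Cons)

text \<open>Writing |y| as \<open>\<bar>y\<bar> powr 1\<close> puts the remainder on the same scale
  of powers as all other error terms.\<close>

lemma power_expansion_iff:
  "power_expansion \<kappa> q xs \<longleftrightarrow> power_list xs \<and> (\<forall>(p, a) \<in> set xs. 1 < p \<and> p < 2) \<and>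
     (\<lambda>y. q y - (\<kappa> * y\<^sup>2 + power_sum xs y)) \<in> o[at_infinity](\<lambda>y. \<bar>y\<bar> powr 1)"
  by (auto simp: power_expansion_def power_list_def power_sum_def)

lemma power_expansion_unique:
  assumes "power_expansion \<kappa> q xs" "power_expansion \<kappa> q ys"
  shows "xs = ys"
proof -
  note E = assms[unfolded power_expansion_iff]
  have "(\<lambda>y. (q y - (\<kappa> * y\<^sup>2 + power_sum ys y)) - (q y - (\<kappa> * y\<^sup>2 + power_sum xs y)))
      \<in> o[at_infinity](\<lambda>y. \<bar>y\<bar> powr 1)"
    by (rule sum_in_smallo(2)) (use E in blast)+
  then have "(\<lambda>y. power_sum xs y - power_sum ys y) \<in> o[at_infinity](\<lambda>y. \<bar>y\<bar> powr 1)"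
    by simp
  with E show ?thesis by (intro power_sum_inject[of xs ys 1]) auto
qed

lemma power_terms_eq:
  assumes "power_expansion \<kappa> q xs"
  shows "power_terms \<kappa> q = xs"
  unfolding power_terms_def using assms power_expansion_unique by blast

section \<open>Critical exponents and signs of the constants\<close>

lemma integral_pos:
  fixes f :: "real \<Rightarrow> real"
  assumes "continuous_on {a..b} f" "a < b" "\<And>x. x \<in> {a..b} \<Longrightarrow> 0 \<le> f x"
    and "x \<in> {a..b}" "0 < f x"
  shows "0 < integral {a..b} f"
proof -
  have "integral {a..b} f \<noteq> 0"
    using integral_eq_0_iff[of a b f] assms by force
  moreover have "0 \<le> integral {a..b} f"
    using assms by (intro integral_nonneg integrable_continuous_real) auto
  ultimately show ?thesis by linarith
qed

lemma J43_pos: "0 < J43"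
  unfolding J43_def
proof (rule integral_pos[where x = "pi / 2"])
  show "continuous_on {0..pi} (\<lambda>u. sin u powr (4 / 3))"
    by (intro continuous_on_powr' continuous_intros) (auto simp: sin_ge_zero)
qed auto

lemma I_const_pos:
  assumes "T > 0" "p > 0"
  shows "0 < I_const T p"
  unfolding I_const_def
proof (rule integral_pos[where x = "T / 2"])
  have nn: "0 \<le> e1 T s" if "s \<in> {0..T}" for s
    using that assms unfolding e1_def
    by (intro mult_nonneg_nonneg sin_ge_zero) (auto simp: field_simps)
  have "continuous_on {0..T} (e1 T)"
    unfolding e1_def by (intro continuous_intros) (use assms in auto)
  then show "continuous_on {0..T} (\<lambda>s. e1 T s powr p)"
    using nn assms by (intro continuous_on_powr' continuous_intros) auto
  have "e1 T (T / 2) = sqrt (2 / T)" using assms by (simp add: e1_def)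
  then show "0 < e1 T (T / 2) powr p" using assms by simp
qed (use assms in auto)

text \<open>The recursion has fixed point 1 and divides the distance to it by 3; this distance is
  1/3 at the start. Strict decrease and the bounds 1 and 2 can be read off.\<close>

lemma beta_eq: "beta n = 1 + (1 / 3) ^ Suc n"
  by (induction n) (simp_all add: field_simps)

lemma beta_bounds: "1 < beta n" "beta n < 2"
  using power_strict_decreasing[of 0 "Suc n" "1 / 3 :: real"] by (auto simp: beta_eq)

lemma beta_strict_antimono: "i < j \<Longrightarrow> beta j < beta i"
  unfolding beta_eq by (simp add: power_strict_decreasing)

lemma b_star_pos: "\<kappa> > 0 \<Longrightarrow> \<sigma> > 0 \<Longrightarrow> 0 < b_star \<kappa> \<sigma>"
  using J43_pos by (simp add: b_star_def)

lemma v_star_pos: "\<kappa> > 0 \<Longrightarrow> \<sigma> > 0 \<Longrightarrow> T > 0 \<Longrightarrow> 0 < v_star \<kappa> \<sigma> T"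
  using b_star_pos[of \<kappa> \<sigma>] I_const_pos[of T "4/3"] by (simp add: v_star_def B_zero_def)

text \<open>Each recursion step multiplies by a positive factor, so the sign of the first
  coefficient persists. Nonvanishing is what later arguments draw from this: it makes the critical
  terms a legitimate \<open>power_list\<close>.\<close>

lemma c_star_neg:
  assumes "\<kappa> > 0" "\<sigma> > 0" "T > 0"
  shows "c_star \<kappa> \<sigma> T n < 0"
proof (induction n)
  case 0
  then show ?case using b_star_pos assms by simp
next
  case (Suc n)
  have "0 < \<sigma>\<^sup>2 * (beta n + 1) * (beta n + 2) * I_const T (beta (Suc n)) *
      v_star \<kappa> \<sigma> T powr beta (Suc n)"
    using beta_bounds(1)[of n] beta_bounds(1)[of "Suc n"] assms v_star_pos[of \<kappa> \<sigma> T]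
      I_const_pos[of T "beta (Suc n)"]
    by (intro mult_pos_pos) (auto simp del: beta.simps)
  then show ?case
    using Suc by (simp add: divide_neg_pos del: beta.simps)
qed

section \<open>Both lengths as the longest critical prefix\<close>

definition critical_terms :: "real \<Rightarrow> real \<Rightarrow> real \<Rightarrow> nat \<Rightarrow> (real \<times> real) list" where
  "critical_terms \<kappa> \<sigma> T k = map (\<lambda>j. (beta j, c_star \<kappa> \<sigma> T j)) [0..<k]"

lemma length_critical_terms [simp]: "length (critical_terms \<kappa> \<sigma> T k) = k"
  by (simp add: critical_terms_def)

lemma critical_terms_Suc:
  "critical_terms \<kappa> \<sigma> T (Suc k) = critical_terms \<kappa> \<sigma> T k @ [(beta k, c_star \<kappa> \<sigma> T k)]"
  by (simp add: critical_terms_def)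

lemma take_critical_terms:
  "j \<le> k \<Longrightarrow> take j (critical_terms \<kappa> \<sigma> T k) = critical_terms \<kappa> \<sigma> T j"
  by (simp add: critical_terms_def take_map)

lemma power_sum_critical_terms:
  "power_sum (critical_terms \<kappa> \<sigma> T k) y = (\<Sum>j<k. c_star \<kappa> \<sigma> T j * \<bar>y\<bar> powr beta j)"
  by (induction k) (auto simp: power_sum_append critical_terms_Suc critical_terms_def[of _ _ _ 0])

lemma critical_terms_bounds:
  assumes "(p, a) \<in> set (critical_terms \<kappa> \<sigma> T k)"
  shows "1 < p \<and> p < 2 \<and> beta (k - 1) \<le> p"
proof -
  obtain j where j: "p = beta j" "j < k"
    using assms by (auto simp: critical_terms_def)
  have "j < k - 1 \<or> j = k - 1" using j by linarith
  then show ?thesis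
    using beta_bounds[of j] beta_strict_antimono[of j "k - 1"] j by (auto intro: less_imp_le)
qed

lemma power_list_critical_terms:
  assumes "\<kappa> > 0" "\<sigma> > 0" "T > 0"
  shows "power_list (critical_terms \<kappa> \<sigma> T k)"
proof -
  have "sorted_wrt (>) (map fst (critical_terms \<kappa> \<sigma> T k))"
    by (auto simp: critical_terms_def sorted_wrt_map sorted_wrt_iff_nth_less beta_strict_antimono)
  then show ?thesis
    using c_star_neg[OF assms] by (auto simp: power_list_def critical_terms_def less_imp_neq)
qed

text \<open>The number \<open>beta (k - 1)\<close> is the smallest exponent among the first
  \<open>k\<close> critical powers and exceeds 1. Errors of that order therefore absorb the
  remainder o(|y|) and every term of \<open>ts\<close> with smaller exponent, while the other terms
  of \<open>ts\<close> must equal the critical ones by \<open>power_sum_inject\<close>.\<close>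

lemma critical_prefix_iff:
  assumes "\<kappa> > 0" "\<sigma> > 0" "T > 0" "power_expansion \<kappa> q ts" "k \<ge> 1"
  shows "(\<lambda>y. q y - (\<kappa> * y\<^sup>2 + (\<Sum>j<k. c_star \<kappa> \<sigma> T j * \<bar>y\<bar> powr beta j)))
       \<in> o[at_infinity](\<lambda>y. \<bar>y\<bar> powr beta (k - 1)) \<longleftrightarrow>
     take k ts = critical_terms \<kappa> \<sigma> T k"
    (is "?f \<in> _ \<longleftrightarrow> _")
proof -
  define b where "b = beta (k - 1)"
  define cs where "cs = critical_terms \<kappa> \<sigma> T k"
  have ts: "power_list ts" using assms(4) by (simp add: power_expansion_iff)
  have rem: "(\<lambda>y. q y - (\<kappa> * y\<^sup>2 + power_sum ts y)) \<in> o[at_infinity](\<lambda>y. \<bar>y\<bar> powr b)"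
  proof (rule smallo_abs_powr_mono[where p = 1])
    show "(\<lambda>y. q y - (\<kappa> * y\<^sup>2 + power_sum ts y)) \<in> o[at_infinity](\<lambda>y. \<bar>y\<bar> powr 1)"
      using assms(4) unfolding power_expansion_iff by blast
    show "1 \<le> b" using beta_bounds(1)[of "k - 1"] by (simp add: b_def)
  qed
  have f: "?f y = (power_sum ts y - power_sum cs y) + (q y - (\<kappa> * y\<^sup>2 + power_sum ts y))" for y
    by (simp add: cs_def power_sum_critical_terms)
  have "?f \<in> o[at_infinity](\<lambda>y. \<bar>y\<bar> powr b) \<longleftrightarrow>
      (\<lambda>y. power_sum ts y - power_sum cs y) \<in> o[at_infinity](\<lambda>y. \<bar>y\<bar> powr b)"
    unfolding f using smallo_add_cancel[OF _ rem] sum_in_smallo(1)[OF _ rem] by (intro iffI)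
  also have "\<dots> \<longleftrightarrow> take k ts = cs"
  proof
    assume L: "(\<lambda>y. power_sum ts y - power_sum cs y) \<in> o[at_infinity](\<lambda>y. \<bar>y\<bar> powr b)"
    define us vs where "us = filter (\<lambda>(p, a). b \<le> p) ts" and "vs = filter (\<lambda>(p, a). p < b) ts"
    have split: "ts = us @ vs"
      unfolding us_def vs_def by (rule power_list_split[OF ts])
    have "power_sum vs \<in> o[at_infinity](\<lambda>y. \<bar>y\<bar> powr b)"
      by (rule power_sum_smallo) (auto simp: vs_def)
    moreover have "(\<lambda>y. (power_sum us y - power_sum cs y) + power_sum vs y)
        \<in> o[at_infinity](\<lambda>y. \<bar>y\<bar> powr b)"
      using L unfolding split power_sum_append by (simp add: algebra_simps)
    ultimately have "(\<lambda>y. power_sum us y - power_sum cs y) \<in> o[at_infinity](\<lambda>y. \<bar>y\<bar> powr b)"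
      by (rule smallo_add_cancel[rotated])
    then have "us = cs"
      using critical_terms_bounds[of _ _ \<kappa> \<sigma> T k] power_list_critical_terms[OF assms(1-3)]
      by (intro power_sum_inject[of us cs b])
        (auto simp: us_def cs_def b_def ts power_list_filter)
    then show "take k ts = cs" by (simp add: split cs_def)
  next
    assume R: "take k ts = cs"
    have ts_eq: "ts = cs @ drop k ts" using R by (metis append_take_drop_id)
    \<comment> \<open>Since \<open>b\<close> is the exponent of the last entry of \<open>cs\<close>,
      sortedness pushes every exponent after the prefix strictly below \<open>b\<close>.\<close>
    have "(b, c_star \<kappa> \<sigma> T (k - 1)) \<in> set cs"
      using assms(5) by (auto simp: cs_def b_def critical_terms_def)
    moreover have "sorted_wrt (>) (map fst cs @ map fst (drop k ts))"
      using ts ts_eq unfolding power_list_def by (metis map_append)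
    ultimately have "p < b" if "(p, a) \<in> set (drop k ts)" for p a
      using that by (force simp: sorted_wrt_append)
    then have "power_sum (drop k ts) \<in> o[at_infinity](\<lambda>y. \<bar>y\<bar> powr b)"
      by (rule power_sum_smallo)
    moreover have "power_sum ts y - power_sum cs y = power_sum (drop k ts) y" for y
      by (subst ts_eq) (simp add: power_sum_append)
    ultimately show "(\<lambda>y. power_sum ts y - power_sum cs y) \<in> o[at_infinity](\<lambda>y. \<bar>y\<bar> powr b)"
      by simp
  qed
  finally show ?thesis by (simp add: b_def cs_def)
qed

text \<open>If no power remains, the algorithm compares \<open>0\<close> with \<open>c_star \<kappa> \<sigma> T n\<close>; it stops there only
  because the latter is nonzero.\<close>

lemma executed_iff:
  assumes "\<kappa> > 0" "\<sigma> > 0" "T > 0"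
  shows "executed \<kappa> \<sigma> T ts n xs \<longleftrightarrow> take n ts = critical_terms \<kappa> \<sigma> T n \<and> xs = drop n ts"
proof
  assume "executed \<kappa> \<sigma> T ts n xs"
  then show "take n ts = critical_terms \<kappa> \<sigma> T n \<and> xs = drop n ts"
  proof induction
    case start
    then show ?case by (simp add: critical_terms_def)
  next
    case (advance n xs p a)
    then obtain ys where ys: "xs = (beta n, c_star \<kappa> \<sigma> T n) # ys"
      using c_star_neg[OF assms, of n] by (auto simp: leading_term_def split: list.splits)
    with advance have "drop n ts = (beta n, c_star \<kappa> \<sigma> T n) # ys" by simp
    moreover have "take (Suc n) ts = take n ts @ take 1 (drop n ts)" "drop (Suc n) ts = drop 1 (drop n ts)"
      using take_add[of n 1 ts] by simp_all
    ultimately have "take (Suc n) ts = take n ts @ [(beta n, c_star \<kappa> \<sigma> T n)]" "drop (Suc n) ts = ys"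
      by simp_all
    \<comment> \<open>The matched term is the head of the list, so removing its first occurrence is
      the same as dropping one entry.\<close>
    moreover have "remove1 (beta n, c_star \<kappa> \<sigma> T n) xs = ys" by (simp add: ys)
    ultimately show ?case using advance by (simp add: critical_terms_Suc)
  qed
next
  assume "take n ts = critical_terms \<kappa> \<sigma> T n \<and> xs = drop n ts"
  then show "executed \<kappa> \<sigma> T ts n xs"
  proof (induction n arbitrary: xs)
    case 0
    then show ?case by (simp add: executed.start)
  next
    case (Suc n)
    \<comment> \<open>The critical list has \<open>Suc n\<close> entries, and a prefix of that
      length exists only if \<open>ts\<close> is long enough.\<close>
    then have len: "n < length ts"
      using arg_cong[of "take (Suc n) ts" _ length] by fastforce
    have "take n ts @ [ts ! n] = critical_terms \<kappa> \<sigma> T n @ [(beta n, c_star \<kappa> \<sigma> T n)]"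
      using Suc.prems len by (simp add: take_Suc_conv_app_nth critical_terms_Suc)
    then have "take n ts = critical_terms \<kappa> \<sigma> T n" and nth: "ts ! n = (beta n, c_star \<kappa> \<sigma> T n)"
      by auto
    moreover have "drop n ts = (beta n, c_star \<kappa> \<sigma> T n) # drop (Suc n) ts"
      using len nth by (simp flip: Cons_nth_drop_Suc)
    ultimately show ?case
      using executed.advance[OF Suc.IH[of "drop n ts"]] Suc.prems by (simp add: leading_term_def)
  qed
qed

text \<open>Matching prefixes are closed under shortening, the empty one always matches, and none is
  longer than \<open>ts\<close>. Their lengths thus form an initial segment, whose top
  \<open>L\<close> is the longest match.\<close>

lemma critical_prefix_lengths:
  "\<exists>L. {n. take n ts = critical_terms \<kappa> \<sigma> T n} = {..L}"
proof -
  define M where "M = {n. take n ts = critical_terms \<kappa> \<sigma> T n}"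
  have le: "n \<le> length ts" if "n \<in> M" for n
  proof -
    have "take n ts = critical_terms \<kappa> \<sigma> T n" using that by (simp add: M_def)
    then have "length (take n ts) = n" by (simp only: length_critical_terms)
    then show ?thesis by simp
  qed
  have fin: "finite M"
    by (rule finite_subset[of _ "{..length ts}"]) (auto dest: le)
  have "0 \<in> M" by (simp add: M_def critical_terms_def)
  have down: "j \<in> M" if "n \<in> M" "j \<le> n" for j n
    using that take_critical_terms[of j n] by (auto simp: M_def) (metis min.absorb1 take_take)
  have "Max M \<in> M"
    using fin \<open>0 \<in> M\<close> by (intro Max_in) auto
  then have "{..Max M} \<subseteq> M"
    using down[of "Max M"] by blast
  moreover have "M \<subseteq> {..Max M}"
    using fin by auto
  ultimately have "M = {..Max M}"
    by (rule equalityI[rotated])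
  then show ?thesis unfolding M_def by blast
qed

text \<open>The two lengths differ by one because stages are counted from 0: the stages entered are
  0 to \<open>L\<close>, of which the last is the terminal one.\<close>

lemma delta_critical_prefix:
  assumes "\<kappa> > 0" "\<sigma> > 0" "T > 0" "power_expansion \<kappa> q ts"
    and L: "{n. take n ts = critical_terms \<kappa> \<sigma> T n} = {..L}"
  shows "delta_cp \<kappa> \<sigma> T q = enat L" "delta_dec \<kappa> \<sigma> T q = enat (Suc L)"
proof -
  have "{0} \<union> {k. k \<ge> 1 \<and>
     (\<lambda>y. q y - (\<kappa> * y\<^sup>2 + (\<Sum>j<k. c_star \<kappa> \<sigma> T j * \<bar>y\<bar> powr beta j)))
       \<in> o[at_infinity](\<lambda>y. \<bar>y\<bar> powr beta (k - 1))} = {0} \<union> {k. k \<ge> 1 \<and> k \<in> {..L}}"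
    unfolding L[symmetric] using critical_prefix_iff[OF assms(1-4)] by blast
  also have "\<dots> = {..L}" by auto
  finally have "delta_cp \<kappa> \<sigma> T q = Sup (enat ` {..L})"
    by (simp add: delta_cp_def)
  also have "\<dots> = enat L"
    by (rule Sup_eqI) auto
  finally show "delta_cp \<kappa> \<sigma> T q = enat L" .
  have "{n. \<exists>xs. executed \<kappa> \<sigma> T (power_terms \<kappa> q) n xs} = {..L}"
    using L by (simp add: executed_iff[OF assms(1-3)] power_terms_eq[OF assms(4)])
  then show "delta_dec \<kappa> \<sigma> T q = enat (Suc L)"
    by (simp add: delta_dec_def Let_def)
qed

section \<open>Realising a prescribed list of powers in the class\<close>

lemma continuous_on_power_sum:
  assumes "\<forall>(p, a) \<in> set xs. 0 < p"
  shows "continuous_on UNIV (power_sum xs)"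
  using assms
proof (induction xs)
  case (Cons x xs)
  obtain p a where x: "x = (p, a)" by fastforce
  have "continuous_on UNIV (\<lambda>y. a * \<bar>y\<bar> powr p + power_sum xs y)"
    using Cons by (intro continuous_intros continuous_on_powr') (auto simp: x)
  then show ?case by (simp add: x)
qed (simp add: power_sum_def[abs_def])

lemma has_real_derivative_abs:
  fixes y :: real
  assumes "y \<noteq> 0"
  shows "(abs has_real_derivative sgn y) (at y)"
proof (cases "y > 0")
  case True
  have "(abs has_real_derivative 1) (at y)"
    by (rule has_field_derivative_transform_within_open[OF DERIV_ident, of "{0<..}"])
      (use True in auto)
  with True show ?thesis by simp
next
  case False
  have "((\<lambda>x. - x) has_real_derivative - 1) (at y)"
    by (intro derivative_intros)
  then have "(abs has_real_derivative - 1) (at y)"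
    by (rule has_field_derivative_transform_within_open[of _ _ _ "{..<0}"])
      (use False assms in auto)
  with False assms show ?thesis by simp
qed

text \<open>The factor \<open>y\<close> makes the primitive odd, so one formula serves both
  half-lines. At 0 the difference quotient is |h|^p, which tends to 0.\<close>

lemma has_real_derivative_mult_abs_powr:
  fixes p y :: real
  assumes "p > 0"
  shows "((\<lambda>y. y * \<bar>y\<bar> powr p) has_real_derivative (p + 1) * \<bar>y\<bar> powr p) (at y)"
proof (cases "y = 0")
  case True
  have "continuous_on UNIV (\<lambda>h::real. \<bar>h\<bar> powr p)"
    using assms by (intro continuous_on_powr' continuous_intros) auto
  then have "((\<lambda>h::real. \<bar>h\<bar> powr p) \<longlongrightarrow> \<bar>0\<bar> powr p) (at 0)"
    by (meson UNIV_I continuous_on_def)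
  then have "((\<lambda>h. (h * \<bar>h\<bar> powr p) / h) \<longlongrightarrow> 0) (at 0)"
    by (rule Lim_transform_eventually[THEN tendsto_eq_rhs]) (simp_all add: eventually_at_filter)
  then show ?thesis using True assms by (simp add: DERIV_def)
next
  case False
  have "((\<lambda>y. y * \<bar>y\<bar> powr p) has_real_derivative
      y * (p * \<bar>y\<bar> powr (p - 1) * sgn y) + \<bar>y\<bar> powr p) (at y)"
    using False by (auto intro!: derivative_eq_intros has_real_derivative_abs)
  moreover have "y * (p * \<bar>y\<bar> powr (p - 1) * sgn y) + \<bar>y\<bar> powr p = (p + 1) * \<bar>y\<bar> powr p"
    using False by (auto simp: powr_diff sgn_if abs_if distrib_right)
  ultimately show ?thesis by (rule DERIV_cong)
qed

text \<open>For positive exponents and nonzero \<open>y\<close>, the resulting sum at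
  \<open>y\<close> is the mean of the original sum over the interval between 0 and \<open>y\<close>;
  multiplied by \<open>y\<close> it is a primitive.\<close>

definition average_terms :: "(real \<times> real) list \<Rightarrow> (real \<times> real) list" where
  "average_terms = map (\<lambda>(p, a). (p, a / (p + 1)))"

lemma has_real_derivative_power_sum:
  assumes "\<forall>(p, a) \<in> set xs. 0 < p"
  shows "((\<lambda>y. y * power_sum (average_terms xs) y) has_real_derivative power_sum xs y) (at y)"
  using assms
proof (induction xs)
  case (Cons x xs)
  obtain p a where x: "x = (p, a)" by fastforce
  have "((\<lambda>y. a / (p + 1) * (y * \<bar>y\<bar> powr p) + y * power_sum (average_terms xs) y)
      has_real_derivative a / (p + 1) * ((p + 1) * \<bar>y\<bar> powr p) + power_sum xs y) (at y)"
    using Cons x by (intro DERIV_add DERIV_cmult has_real_derivative_mult_abs_powr) auto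
  moreover have "a / (p + 1) * ((p + 1) * \<bar>y\<bar> powr p) = a * \<bar>y\<bar> powr p"
    using Cons.prems by (simp add: x)
  ultimately show ?case by (simp add: x average_terms_def distrib_left mult.left_commute mult.commute)
qed (simp add: average_terms_def)

lemma power_sum_over_square_tendsto_0:
  assumes "\<forall>(p, a) \<in> set xs. p < 2"
  shows "((\<lambda>y. power_sum xs y / y\<^sup>2) \<longlongrightarrow> 0) at_infinity"
proof -
  have "power_sum xs \<in> o[at_infinity](\<lambda>y. \<bar>y\<bar> powr 2)"
    using assms by (intro power_sum_smallo) auto
  then show ?thesis by (simp add: smalloD_tendsto)
qed

lemma square_plus_power_sum_asymp:
  assumes "\<forall>(p, a) \<in> set xs. p < 2"
  shows "((\<lambda>y. (c * y\<^sup>2 + power_sum xs y + K) / y\<^sup>2) \<longlongrightarrow> c) at_infinity"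
proof -
  have "((\<lambda>y. c + power_sum xs y / y\<^sup>2 + K * inverse y ^ 2) \<longlongrightarrow> c + 0 + K * 0 ^ 2) at_infinity"
    by (intro tendsto_intros tendsto_inverse_0 power_sum_over_square_tendsto_0 assms)
  then have "((\<lambda>y. c + power_sum xs y / y\<^sup>2 + K * inverse y ^ 2) \<longlongrightarrow> c) at_infinity"
    by simp
  moreover have "eventually (\<lambda>y::real. y \<noteq> 0) at_infinity"
    by (rule eventually_not_equal_at_infinity)
  ultimately show ?thesis
    by (elim Lim_transform_eventually) (auto elim!: eventually_mono simp: field_simps)
qed

lemma filterlim_square_plus_power_sum:
  assumes "c > 0" "\<forall>(p, a) \<in> set xs. p < 2"
  shows "filterlim (\<lambda>y. c * y\<^sup>2 + power_sum xs y + K) at_top at_infinity"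
proof -
  have "filterlim (\<lambda>y::real. \<bar>y\<bar> ^ 2) at_top at_infinity"
    by (intro filterlim_pow_at_top filterlim_abs_at_infinity) simp
  then have "filterlim (\<lambda>y. (c * y\<^sup>2 + power_sum xs y + K) / y\<^sup>2 * y\<^sup>2) at_top at_infinity"
    by (intro filterlim_tendsto_pos_mult_at_top[OF square_plus_power_sum_asymp assms(1)] assms) simp
  moreover have "eventually (\<lambda>y::real. y \<noteq> 0) at_infinity"
    by (rule eventually_not_equal_at_infinity)
  ultimately show ?thesis
    by (elim filterlim_mono_eventually[OF _ order_refl order_refl]) (erule eventually_mono, simp)
qed

text \<open>The quadratic term wins outside a large ball, and inside it continuity gives a minimum
  on a compact set. The constant is the absolute value of that minimum plus 1.\<close>

lemma square_plus_power_sum_bounded_below: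
  assumes "c > 0" "\<forall>(p, a) \<in> set xs. 0 < p \<and> p < 2"
  obtains K where "\<And>y. c * y\<^sup>2 + power_sum xs y + K > 0"
proof -
  have "eventually (\<lambda>y. c * y\<^sup>2 + power_sum xs y + 0 > 0) at_infinity"
    using filterlim_square_plus_power_sum[of c xs 0] assms
    by (fastforce simp: filterlim_at_top_dense)
  then obtain R where R: "\<And>y. R \<le> \<bar>y\<bar> \<Longrightarrow> 0 < c * y\<^sup>2 + power_sum xs y"
    by (auto simp: eventually_at_infinity)
  have "continuous_on UNIV (power_sum xs)"
    using assms by (intro continuous_on_power_sum) auto
  then have "continuous_on (cball 0 \<bar>R\<bar>) (\<lambda>y. c * y\<^sup>2 + power_sum xs y)"
    by (intro continuous_intros) (auto intro: continuous_on_subset)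
  then obtain z where z: "\<And>y. \<bar>y\<bar> \<le> \<bar>R\<bar> \<Longrightarrow> c * z\<^sup>2 + power_sum xs z \<le> c * y\<^sup>2 + power_sum xs y"
    using continuous_attains_inf[of "cball 0 \<bar>R\<bar>" "\<lambda>y. c * y\<^sup>2 + power_sum xs y"] by fastforce
  have "c * y\<^sup>2 + power_sum xs y + (\<bar>c * z\<^sup>2 + power_sum xs z\<bar> + 1) > 0" for y
  proof (cases "\<bar>y\<bar> \<le> \<bar>R\<bar>")
    case True
    show ?thesis using z[OF True] by linarith
  next
    case False
    then show ?thesis using R[of y] by linarith
  qed
  then show ?thesis using that by blast
qed

text \<open>Adding a constant \<open>K\<close> to the prescribed powers makes \<open>q\<close>
  positive, hence its negative primitive strictly decreasing, and does not disturb the expansion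
  because a constant is o(|y|).\<close>

lemma P_sym_realisation:
  assumes "\<kappa> > 0" "power_list xs" "\<forall>(p, a) \<in> set xs. 1 < p \<and> p < 2"
  obtains q where "q \<in> P_sym \<kappa> \<sigma>" "power_expansion \<kappa> q xs"
proof -
  have bds: "\<forall>(p, a) \<in> set xs. 0 < p" "\<forall>(p, a) \<in> set xs. 0 < p \<and> p < 2"
      "\<forall>(p, a) \<in> set xs. p < 2" "\<forall>(p, a) \<in> set (average_terms xs). p < 2"
    using assms(3) by (force simp: average_terms_def)+
  obtain K where K: "\<And>y. \<kappa> * y\<^sup>2 + power_sum xs y + K > 0"
    using square_plus_power_sum_bounded_below[OF assms(1) bds(2)] by blast
  define q where "q = (\<lambda>y. \<kappa> * y\<^sup>2 + power_sum xs y + K)"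
  define h where "h = (\<lambda>y. \<kappa> / 3 * y\<^sup>2 + power_sum (average_terms xs) y + K)"
  \<comment> \<open>This is minus the primitive of \<open>q\<close> that vanishes at 0. Its factor
    \<open>h\<close> is the mean of \<open>q\<close>, which turns superlinearity into divergence of
    \<open>h\<close>.\<close>
  define lam where "lam = (\<lambda>y. - (y * h y))"
  have der: "(lam has_real_derivative - q y) (at y)" for y
  proof -
    have "((\<lambda>y. - (\<kappa> / 3 * y ^ 3 + y * power_sum (average_terms xs) y + K * y)) has_real_derivative
        - (\<kappa> / 3 * (3 * y\<^sup>2) + power_sum xs y + K)) (at y)"
      by (rule derivative_eq_intros has_real_derivative_power_sum[OF bds(1)] refl | simp)+
    then show ?thesis
      by (simp add: lam_def q_def h_def algebra_simps power2_eq_square power3_eq_cube)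
  qed
  have deriv: "q = (\<lambda>y. - deriv lam y)"
    using DERIV_imp_deriv[OF der] by simp
  have lam0: "lam 0 = 0" by (simp add: lam_def)
  have "continuous_on UNIV q"
    unfolding q_def by (intro continuous_intros continuous_on_power_sum bds)
  then have "lam C1_differentiable_on UNIV"
    unfolding C1_differentiable_on_def
    by (intro exI[of _ "\<lambda>y. - q y"]) (auto intro!: continuous_intros der simp flip: has_real_derivative_iff_has_vector_derivative)
  moreover have "strict_antimono_on UNIV lam"
  proof (rule monotone_onI)
    fix x y :: real assume "x < y"
    then show "lam x > lam y"
    proof (rule DERIV_neg_imp_decreasing)
      fix z
      show "\<exists>d. (lam has_real_derivative d) (at z) \<and> d < 0"
        using der[of z] K[of z] by (intro exI[of _ "- q z"]) (simp add: q_def)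
    qed
  qed
  ultimately have D: "lam \<in> class_D" using lam0 by (auto simp: class_D_def)
  have nz: "eventually (\<lambda>y::real. y \<noteq> 0) at_infinity"
    by (rule eventually_not_equal_at_infinity)
  have h_lim: "filterlim h at_top at_infinity"
    unfolding h_def using assms(1) by (intro filterlim_square_plus_power_sum bds) auto
  have "filterlim (\<lambda>y. \<bar>lam y\<bar> / \<bar>y - 0\<bar>) at_top at_infinity"
  proof (rule filterlim_at_top_mono[OF h_lim])
    show "eventually (\<lambda>y. h y \<le> \<bar>lam y\<bar> / \<bar>y - 0\<bar>) at_infinity"
      using nz by eventually_elim (auto simp: lam_def abs_mult)
  qed
  moreover have "((\<lambda>y. \<sigma>\<^sup>2 * q y / (lam y)\<^sup>2) \<longlongrightarrow> 0) at_infinity"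
  proof -
    \<comment> \<open>Both \<open>q\<close> and \<open>h\<close> grow like y^2, with factors
      \<open>\<kappa>\<close> and \<open>\<kappa> / 3\<close>, so \<open>lam\<close> squared grows
      like y^6 and the quotient decays like y^(-4).\<close>
    have "((\<lambda>y. \<sigma>\<^sup>2 * (q y / y\<^sup>2) / (h y / y\<^sup>2)\<^sup>2 * (inverse y) ^ 4) \<longlongrightarrow>
        \<sigma>\<^sup>2 * \<kappa> / (\<kappa> / 3)\<^sup>2 * 0 ^ 4) at_infinity"
      unfolding q_def h_def using assms(1)
      by (intro tendsto_intros tendsto_inverse_0 square_plus_power_sum_asymp bds) auto
    then have "((\<lambda>y. \<sigma>\<^sup>2 * (q y / y\<^sup>2) / (h y / y\<^sup>2)\<^sup>2 * (inverse y) ^ 4) \<longlongrightarrow> 0) at_infinity"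
      by simp
    then show ?thesis
    proof (rule Lim_transform_eventually)
      show "eventually (\<lambda>y. \<sigma>\<^sup>2 * (q y / y\<^sup>2) / (h y / y\<^sup>2)\<^sup>2 * (inverse y) ^ 4 =
          \<sigma>\<^sup>2 * q y / (lam y)\<^sup>2) at_infinity"
        using nz by eventually_elim
          (auto simp: lam_def power_mult_distrib power_divide field_simps eval_nat_numeral)
    qed
  qed
  then have "((\<lambda>y. ereal (\<sigma>\<^sup>2 * (- deriv lam y) / (lam y)\<^sup>2)) \<longlongrightarrow> 0) at_infinity"
    using deriv by (simp add: fun_eq_iff zero_ereal_def)
  then have "Limsup at_infinity (\<lambda>y. ereal (\<sigma>\<^sup>2 * (- deriv lam y) / (lam y)\<^sup>2)) = 0"
    by (rule lim_imp_Limsup[OF trivial_limit_at_infinity])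
  ultimately have "lam \<in> class_D_star \<sigma>"
    using D lam0 unfolding class_D_star_def by blast
  moreover have E: "power_expansion \<kappa> q xs"
  proof -
    have "(\<lambda>y::real. K * \<bar>y\<bar> powr 0) \<in> o[at_infinity](\<lambda>y. \<bar>y\<bar> powr 1)"
      using abs_powr_smallo_iff[of 0 1] by (cases "K = 0") simp_all
    \<comment> \<open>The equality fails at 0 when \<open>K\<close> is nonzero, since
      \<open>0 powr 0\<close> is 0, so it is claimed only eventually.\<close>
    moreover have "eventually (\<lambda>y::real. K * \<bar>y\<bar> powr 0 = q y - (\<kappa> * y\<^sup>2 + power_sum xs y)) at_infinity"
      using nz by eventually_elim (simp add: q_def)
    ultimately have "(\<lambda>y. q y - (\<kappa> * y\<^sup>2 + power_sum xs y)) \<in> o[at_infinity](\<lambda>y. \<bar>y\<bar> powr 1)"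
      by (rule iffD1[OF landau_o.small.in_cong, rotated])
    then show ?thesis using assms by (simp add: power_expansion_iff)
  qed
  ultimately have "q \<in> P_sym \<kappa> \<sigma>"
    unfolding P_sym_def using deriv lam0 by blast
  with E show ?thesis using that by blast
qed

theorem proposition4p30:
  fixes \<kappa> \<sigma> T :: real
  assumes "\<kappa> > 0" and "\<sigma> > 0" and "T > 0"
    and "\<kappa> * \<sigma>\<^sup>2 * T\<^sup>2 = pi\<^sup>2"
  shows "(\<forall>q \<in> P_sym \<kappa> \<sigma>.
            delta_dec \<kappa> \<sigma> T q = delta_cp \<kappa> \<sigma> T q + 1 \<and> delta_cp \<kappa> \<sigma> T q + 1 < \<infinity>) \<and>
         (SUP q \<in> P_sym \<kappa> \<sigma>. delta_dec \<kappa> \<sigma> T q) = \<infinity>"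
proof
  show "\<forall>q \<in> P_sym \<kappa> \<sigma>.
      delta_dec \<kappa> \<sigma> T q = delta_cp \<kappa> \<sigma> T q + 1 \<and> delta_cp \<kappa> \<sigma> T q + 1 < \<infinity>"
  proof
    fix q assume "q \<in> P_sym \<kappa> \<sigma>"
    then obtain ts where ts: "power_expansion \<kappa> q ts" by (auto simp: P_sym_def)
    obtain L where L: "{n. take n ts = critical_terms \<kappa> \<sigma> T n} = {..L}"
      using critical_prefix_lengths by blast
    show "delta_dec \<kappa> \<sigma> T q = delta_cp \<kappa> \<sigma> T q + 1 \<and> delta_cp \<kappa> \<sigma> T q + 1 < \<infinity>"
      using delta_critical_prefix[OF assms(1-3) ts L] by (simp add: one_enat_def)
  qed
  have "enat k \<le> (SUP q \<in> P_sym \<kappa> \<sigma>. delta_dec \<kappa> \<sigma> T q)" for k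
  proof -
    \<comment> \<open>An expansion consisting of exactly the first \<open>k\<close> critical powers
      carries the algorithm at least to stage \<open>k\<close>.\<close>
    define ts where "ts = critical_terms \<kappa> \<sigma> T k"
    obtain q where q: "q \<in> P_sym \<kappa> \<sigma>" "power_expansion \<kappa> q ts"
      using P_sym_realisation[of \<kappa> ts \<sigma>] assms(1) power_list_critical_terms[OF assms(1-3), of k]
        critical_terms_bounds[of _ _ \<kappa> \<sigma> T k]
      unfolding ts_def by blast
    obtain L where L: "{n. take n ts = critical_terms \<kappa> \<sigma> T n} = {..L}"
      using critical_prefix_lengths by blast
    have "k \<in> {n. take n ts = critical_terms \<kappa> \<sigma> T n}" by (simp add: ts_def)
    then have "k \<le> L" unfolding L by simp
    then have "enat k \<le> delta_dec \<kappa> \<sigma> T q"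
      using delta_critical_prefix(2)[OF assms(1-3) q(2) L] by simp
    then show ?thesis using q(1) by (rule SUP_upper2[rotated])
  qed
  then show "(SUP q \<in> P_sym \<kappa> \<sigma>. delta_dec \<kappa> \<sigma> T q) = \<infinity>"
    \<comment> \<open>A finite supremum n would contradict the lower bound for k = n + 1.\<close>
    by (metis Suc_n_not_le_n enat_ord_simps(1) not_infinity_eq)
qed

end
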